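(* Let $k\ge1$ and let $\Sigma_{L^k}=(M,L,Fe)$ be a Lagrangian mechanical system of order $k$. The Lagrange equations $$\frac{d}{dt}\frac{\partial L}{\partial y^{(k)i}}-\frac{\partial L}{\partial y^{(k-1)i}}=F_i,\qquad y^{(1)i}=\frac{dx^i}{dt},\ \dots,\ y^{(k)i}=\frac1{k!}\frac{d^kx^i}{dt^k},$$ are equivalent to the following system of differential equations of order $k+1$: $$\frac{d^{k+1}x^i}{dt^{k+1}}+(k+1)!\,\mathring G^i\left(x,\frac{dx}{dt},\dots,\frac1{k!}\frac{d^kx}{dt^k}\right)=\frac{k!}{2}F^i\left(x,\frac{dx}{dt},\dots,\frac1{k!}\frac{d^kx}{dt^k}\right),$$ with the coefficients $$(k+1)\mathring G^i=\frac12g^{ij}\left[\Gamma\left(\frac{\partial L}{\partial y^{(k)j}}\right)-\frac{\partial L}{\partial y^{(k-1)j}}\right].$$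
   Context: The summation convention is used. $M$ is a real $n$-dimensional smooth manifold. $T^kM$ is the bundle of accelerations of order $k$ (the manifold of $k$-jets at $0$ of curves in $M$), with local coordinates $(x^i,y^{(1)i},\dots,y^{(k)i})$, where the $k$-jet of a curve $x(t)$ has $y^{(\alpha)i}=\frac1{\alpha!}\frac{d^\alpha x^i}{dt^\alpha}(0)$; $y^{(0)i}=x^i$; $\widetilde{T^kM}$ is $T^kM$ without the null section. $\Gamma$ is the operator $\Gamma=y^{(1)i}\frac{\partial}{\partial x^i}+2y^{(2)i}\frac{\partial}{\partial y^{(1)i}}+\dots+ky^{(k)i}\frac{\partial}{\partial y^{(k-1)i}}$ (in a given chart). A Lagrange space of order $k$ is a pair $(M,L)$ with $L:T^kM\to\mathbb R$ smooth on $\widetilde{T^kM}$ and continuous on the null section, such that $g_{ij}=\frac12\frac{\partial^2L}{\partial y^{(k)i}\partial y^{(k)j}}$ is nonsingular and of constant signature on $\widetilde{T^kM}$; $(g^{ij})$ is the inverse matrix. A Lagrangian mechanical system of order $k$ is a triple $\Sigma_{L^k}=(M,L,Fe)$ where $(M,L)$ is a Lagrange space of order $k$ and $Fe=F^i(x,y^{(1)},\dots,y^{(k)})\frac{\partial}{\partial y^{(k)i}}$ is a given vertical vector field on $T^kM$, with covariant components $F_i=g_{ij}F^j$. *)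

theory Defs
  imports "HOL-Analysis.Analysis"
begin

section \<open>Smooth functions of finitely many coordinates\<close>

text \<open>A coordinate direction on a space is given by the map that displaces a point by a real
  number along that coordinate. This lets one definition of class \<open>C\<^sup>r\<close>, by iterated
  partial derivatives, serve both \<open>real^'n\<close> and the coordinate space of a jet bundle.\<close>

definition pderiv_along :: "(real \<Rightarrow> 'u \<Rightarrow> 'u) \<Rightarrow> ('u \<Rightarrow> real) \<Rightarrow> 'u \<Rightarrow> real" where
  "pderiv_along h f u = deriv (\<lambda>s. f (h s u)) 0"

primrec Cr_on ::
    "nat \<Rightarrow> (real \<Rightarrow> 'u \<Rightarrow> 'u) set \<Rightarrow> 'u::topological_space set \<Rightarrow> ('u \<Rightarrow> real) \<Rightarrow> bool" where
  "Cr_on 0 H W f \<longleftrightarrow> continuous_on W f"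
| "Cr_on (Suc r) H W f \<longleftrightarrow> continuous_on W f \<and>
     (\<forall>h\<in>H. (\<forall>u\<in>W. (\<lambda>s. f (h s u)) field_differentiable at 0) \<and>
            Cr_on r H W (pderiv_along h f))"

definition smooth_along ::
    "(real \<Rightarrow> 'u \<Rightarrow> 'u) set \<Rightarrow> 'u::topological_space set \<Rightarrow> ('u \<Rightarrow> real) \<Rightarrow> bool" where
  "smooth_along H W f \<longleftrightarrow> (\<forall>r. Cr_on r H W f)"

definition displace :: "'n::finite \<Rightarrow> real \<Rightarrow> real^'n \<Rightarrow> real^'n" where
  "displace i s x = x + s *\<^sub>R axis i 1"

definition partial :: "'n::finite \<Rightarrow> (real^'n \<Rightarrow> real) \<Rightarrow> real^'n \<Rightarrow> real" where
  "partial i = pderiv_along (displace i)"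

definition smooth_map_on :: "(real^'n::finite) set \<Rightarrow> (real^'n \<Rightarrow> real^'n) \<Rightarrow> bool" where
  "smooth_map_on W f \<longleftrightarrow> (\<forall>i. smooth_along (range displace) W (\<lambda>x. f x $ i))"

definition Cr_real_on :: "nat \<Rightarrow> real set \<Rightarrow> (real \<Rightarrow> real) \<Rightarrow> bool" where
  "Cr_real_on r S f \<longleftrightarrow>
     (\<forall>m<r. \<forall>t\<in>S. (deriv ^^ m) f field_differentiable at t) \<and> continuous_on S ((deriv ^^ r) f)"


section \<open>Smooth manifolds and curves\<close>

type_synonym ('m, 'n) chart = "'m set \<times> ('m \<Rightarrow> real^'n)"

definition is_chart :: "'m topology \<Rightarrow> ('m, 'n::finite) chart \<Rightarrow> bool" where
  "is_chart X = (\<lambda>(U, \<phi>). openin X U \<and> open (\<phi> ` U) \<and>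
     homeomorphic_map (subtopology X U) (top_of_set (\<phi> ` U)) \<phi>)"

text \<open>The dimension is \<open>CARD('n)\<close>. The atlas need not be maximal.\<close>

definition smooth_manifold :: "'m topology \<Rightarrow> ('m, 'n::finite) chart set \<Rightarrow> bool" where
  "smooth_manifold X A \<longleftrightarrow>
     Hausdorff_space X \<and> second_countable X \<and>
     (\<forall>C\<in>A. is_chart X C) \<and> (\<Union>(U, \<phi>)\<in>A. U) = topspace X \<and>
     (\<forall>(U, \<phi>)\<in>A. \<forall>(V, \<psi>)\<in>A. smooth_map_on (\<phi> ` (U \<inter> V)) (\<psi> \<circ> inv_into U \<phi>))"

definition Cr_curve ::
    "'m topology \<Rightarrow> ('m, 'n::finite) chart set \<Rightarrow> nat \<Rightarrow> real set \<Rightarrow> (real \<Rightarrow> 'm) \<Rightarrow> bool" where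
  "Cr_curve X A r I c \<longleftrightarrow>
     continuous_map (top_of_set I) X c \<and>
     (\<forall>(U, \<phi>)\<in>A. \<forall>i. Cr_real_on r {t\<in>I. c t \<in> U} (\<lambda>t. \<phi> (c t) $ i))"


section \<open>The bundle of accelerations of order \<open>k\<close>\<close>

text \<open>A point of the coordinate space is a sequence \<open>u\<close> with \<open>u \<alpha>\<close> standing for
  \<open>y\<^sup>(\<^sup>\<alpha>\<^sup>)\<close> when \<open>\<alpha> \<le> k\<close> (so \<open>u 0\<close> is \<open>x\<close>) and \<open>u \<alpha> = 0\<close> when \<open>\<alpha> > k\<close>. With the product
  topology these sequences form a copy of the Euclidean space of \<open>k + 1\<close> vectors.\<close>

definition curve_coords ::
    "('m \<Rightarrow> real^'n::finite) \<Rightarrow> nat \<Rightarrow> (real \<Rightarrow> 'm) \<Rightarrow> real \<Rightarrow> nat \<Rightarrow> real^'n" where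
  "curve_coords \<phi> k c t =
     (\<lambda>\<alpha>. if \<alpha> \<le> k then \<chi> i. (deriv ^^ \<alpha>) (\<lambda>s. \<phi> (c s) $ i) t / fact \<alpha> else 0)"

definition curve_germs ::
    "'m topology \<Rightarrow> ('m, 'n::finite) chart set \<Rightarrow> nat \<Rightarrow> (real \<Rightarrow> 'm) set" where
  "curve_germs X A k = {c. \<exists>e>0. Cr_curve X A k {-e<..<e} c}"

definition jet_rel ::
    "'m topology \<Rightarrow> ('m, 'n::finite) chart set \<Rightarrow> nat \<Rightarrow> ((real \<Rightarrow> 'm) \<times> (real \<Rightarrow> 'm)) set" where
  "jet_rel X A k = {(c, d). c \<in> curve_germs X A k \<and> d \<in> curve_germs X A k \<and> c 0 = d 0 \<and>
     (\<exists>(U, \<phi>)\<in>A. c 0 \<in> U \<and> curve_coords \<phi> k c 0 = curve_coords \<phi> k d 0)}"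

definition jet ::
    "'m topology \<Rightarrow> ('m, 'n::finite) chart set \<Rightarrow> nat \<Rightarrow> (real \<Rightarrow> 'm) \<Rightarrow> (real \<Rightarrow> 'm) set" where
  "jet X A k c = jet_rel X A k `` {c}"

definition acc_bundle ::
    "'m topology \<Rightarrow> ('m, 'n::finite) chart set \<Rightarrow> nat \<Rightarrow> (real \<Rightarrow> 'm) set set" where
  "acc_bundle X A k = curve_germs X A k // jet_rel X A k"

definition null_section ::
    "'m topology \<Rightarrow> ('m, 'n::finite) chart set \<Rightarrow> nat \<Rightarrow> (real \<Rightarrow> 'm) set set" where
  "null_section X A k = {J \<in> acc_bundle X A k. \<exists>p. (\<lambda>_. p) \<in> J}"

definition slit_acc_bundle ::
    "'m topology \<Rightarrow> ('m, 'n::finite) chart set \<Rightarrow> nat \<Rightarrow> (real \<Rightarrow> 'm) set set" where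
  "slit_acc_bundle X A k = acc_bundle X A k - null_section X A k"

text \<open>The next two sets are the images, under the coordinates induced by a chart \<open>(U, \<phi>)\<close>, of
  the part of the bundle lying over \<open>U\<close> and of that part without the null section.\<close>

definition jet_domain :: "('m, 'n::finite) chart \<Rightarrow> nat \<Rightarrow> (nat \<Rightarrow> real^'n) set" where
  "jet_domain = (\<lambda>(U, \<phi>) k. {u. u 0 \<in> \<phi> ` U \<and> (\<forall>\<alpha>>k. u \<alpha> = 0)})"

definition slit_jet_domain :: "('m, 'n::finite) chart \<Rightarrow> nat \<Rightarrow> (nat \<Rightarrow> real^'n) set" where
  "slit_jet_domain C k = {u \<in> jet_domain C k. \<exists>\<alpha>\<in>{1..k}. u \<alpha> \<noteq> 0}"

text \<open>The jet with coordinates \<open>u\<close> is that of the curve which is polynomial in the chart, with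
  Taylor coefficients \<open>u\<close>.\<close>

definition jet_of_coords ::
    "'m topology \<Rightarrow> ('m, 'n::finite) chart set \<Rightarrow> nat \<Rightarrow> ('m, 'n) chart \<Rightarrow> (nat \<Rightarrow> real^'n)
      \<Rightarrow> (real \<Rightarrow> 'm) set" where
  "jet_of_coords X A k =
     (\<lambda>(U, \<phi>) u. jet X A k (\<lambda>s. inv_into U \<phi> (\<Sum>\<alpha>\<le>k. s ^ \<alpha> *\<^sub>R u \<alpha>)))"

definition local_rep ::
    "'m topology \<Rightarrow> ('m, 'n::finite) chart set \<Rightarrow> nat \<Rightarrow> ((real \<Rightarrow> 'm) set \<Rightarrow> real)
      \<Rightarrow> ('m, 'n) chart \<Rightarrow> (nat \<Rightarrow> real^'n) \<Rightarrow> real" where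
  "local_rep X A k L C u = L (jet_of_coords X A k C u)"

definition jet_displace ::
    "nat \<Rightarrow> 'n::finite \<Rightarrow> real \<Rightarrow> (nat \<Rightarrow> real^'n) \<Rightarrow> (nat \<Rightarrow> real^'n)" where
  "jet_displace \<alpha> i s u = u(\<alpha> := displace i s (u \<alpha>))"

definition jet_partial ::
    "nat \<Rightarrow> 'n::finite \<Rightarrow> ((nat \<Rightarrow> real^'n) \<Rightarrow> real) \<Rightarrow> (nat \<Rightarrow> real^'n) \<Rightarrow> real" where
  "jet_partial \<alpha> i = pderiv_along (jet_displace \<alpha> i)"

definition jet_smooth_on ::
    "nat \<Rightarrow> (nat \<Rightarrow> real^'n::finite) set \<Rightarrow> ((nat \<Rightarrow> real^'n) \<Rightarrow> real) \<Rightarrow> bool" where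
  "jet_smooth_on k W f \<longleftrightarrow> smooth_along {jet_displace \<alpha> i |\<alpha> i. \<alpha> \<le> k} W f"

definition Gamma_op ::
    "nat \<Rightarrow> ((nat \<Rightarrow> real^'n::finite) \<Rightarrow> real) \<Rightarrow> (nat \<Rightarrow> real^'n) \<Rightarrow> real" where
  "Gamma_op k f u = (\<Sum>\<alpha>=1..k. \<Sum>i\<in>UNIV. real \<alpha> * (u \<alpha> $ i) * jet_partial (\<alpha> - 1) i f u)"


section \<open>Lagrange spaces and Lagrangian mechanical systems of order \<open>k\<close>\<close>

definition positive_index :: "real^'n^'n::finite \<Rightarrow> nat" where
  "positive_index B = Max (dim ` {V. subspace V \<and> (\<forall>v\<in>V. v \<noteq> 0 \<longrightarrow> v \<bullet> (B *v v) > 0)})"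

definition signature :: "real^'n^'n::finite \<Rightarrow> nat \<times> nat" where
  "signature B = (positive_index B, positive_index (- B))"

definition metric ::
    "nat \<Rightarrow> ((nat \<Rightarrow> real^'n::finite) \<Rightarrow> real) \<Rightarrow> (nat \<Rightarrow> real^'n) \<Rightarrow> real^'n^'n" where
  "metric k f u = (\<chi> i j. 1/2 * jet_partial k i (jet_partial k j f) u)"

definition lagrange_space ::
    "'m topology \<Rightarrow> ('m, 'n::finite) chart set \<Rightarrow> nat \<Rightarrow> ((real \<Rightarrow> 'm) set \<Rightarrow> real) \<Rightarrow> bool" where
  "lagrange_space X A k L \<longleftrightarrow>
     smooth_manifold X A \<and>
     (\<forall>C\<in>A. jet_smooth_on k (slit_jet_domain C k) (local_rep X A k L C)) \<and>
     (\<forall>C\<in>A. \<forall>u \<in> jet_domain C k - slit_jet_domain C k.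
        continuous (at u within jet_domain C k) (local_rep X A k L C)) \<and>
     (\<forall>C\<in>A. \<forall>u \<in> slit_jet_domain C k. invertible (metric k (local_rep X A k L C) u)) \<and>
     (\<exists>\<sigma>. \<forall>C\<in>A. \<forall>u \<in> slit_jet_domain C k. signature (metric k (local_rep X A k L C) u) = \<sigma>)"

text \<open>A vertical field \<open>F\<^sup>i \<partial>/\<partial>y\<^sup>(\<^sup>k\<^sup>)\<^sup>i\<close> is given by its components in each chart.
  Under a change of chart \<open>\<tau>\<close> the fields \<open>\<partial>/\<partial>y\<^sup>(\<^sup>k\<^sup>)\<^sup>j\<close> are transformed by the Jacobian matrix
  of \<open>\<tau>\<close> alone, which is the compatibility condition below.\<close>

definition vertical_field ::
    "'m topology \<Rightarrow> ('m, 'n::finite) chart set \<Rightarrow> nat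
      \<Rightarrow> (('m, 'n) chart \<Rightarrow> (nat \<Rightarrow> real^'n) \<Rightarrow> real^'n) \<Rightarrow> bool" where
  "vertical_field X A k F \<longleftrightarrow>
     (\<forall>C\<in>A. \<forall>i. jet_smooth_on k (jet_domain C k) (\<lambda>u. F C u $ i)) \<and>
     (\<forall>(U, \<phi>)\<in>A. \<forall>(V, \<psi>)\<in>A. \<forall>c \<in> curve_germs X A k. c 0 \<in> U \<inter> V \<longrightarrow>
        (\<forall>i. F (V, \<psi>) (curve_coords \<psi> k c 0) $ i =
          (\<Sum>j\<in>UNIV. partial j (\<lambda>x. \<psi> (inv_into U \<phi> x) $ i) (\<phi> (c 0)) *
             F (U, \<phi>) (curve_coords \<phi> k c 0) $ j)))"

definition lagrangian_mechanical_system ::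
    "'m topology \<Rightarrow> ('m, 'n::finite) chart set \<Rightarrow> nat \<Rightarrow> ((real \<Rightarrow> 'm) set \<Rightarrow> real)
      \<Rightarrow> (('m, 'n) chart \<Rightarrow> (nat \<Rightarrow> real^'n) \<Rightarrow> real^'n) \<Rightarrow> bool" where
  "lagrangian_mechanical_system X A k L F \<longleftrightarrow> lagrange_space X A k L \<and> vertical_field X A k F"

definition covariant_components ::
    "nat \<Rightarrow> ((nat \<Rightarrow> real^'n::finite) \<Rightarrow> real) \<Rightarrow> ((nat \<Rightarrow> real^'n) \<Rightarrow> real^'n)
      \<Rightarrow> (nat \<Rightarrow> real^'n) \<Rightarrow> real^'n" where
  "covariant_components k f F u = (\<chi> i. \<Sum>j\<in>UNIV. metric k f u $ i $ j * F u $ j)"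

definition spray_coeff ::
    "nat \<Rightarrow> ((nat \<Rightarrow> real^'n::finite) \<Rightarrow> real) \<Rightarrow> (nat \<Rightarrow> real^'n) \<Rightarrow> real^'n" where
  "spray_coeff k f u = (\<chi> i. 1 / real (k + 1) * (1/2 * (\<Sum>j\<in>UNIV. matrix_inv (metric k f u) $ i $ j *
     (Gamma_op k (jet_partial k j f) u - jet_partial (k - 1) j f u))))"

definition lagrange_equations ::
    "nat \<Rightarrow> ((nat \<Rightarrow> real^'n::finite) \<Rightarrow> real) \<Rightarrow> ((nat \<Rightarrow> real^'n) \<Rightarrow> real^'n)
      \<Rightarrow> ('m \<Rightarrow> real^'n) \<Rightarrow> (real \<Rightarrow> 'm) \<Rightarrow> real \<Rightarrow> bool" where
  "lagrange_equations k f F \<phi> c t \<longleftrightarrow>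
     (\<forall>i. deriv (\<lambda>\<tau>. jet_partial k i f (curve_coords \<phi> k c \<tau>)) t
            - jet_partial (k - 1) i f (curve_coords \<phi> k c t)
          = covariant_components k f F (curve_coords \<phi> k c t) $ i)"

definition spray_equations ::
    "nat \<Rightarrow> ((nat \<Rightarrow> real^'n::finite) \<Rightarrow> real) \<Rightarrow> ((nat \<Rightarrow> real^'n) \<Rightarrow> real^'n)
      \<Rightarrow> ('m \<Rightarrow> real^'n) \<Rightarrow> (real \<Rightarrow> 'm) \<Rightarrow> real \<Rightarrow> bool" where
  "spray_equations k f F \<phi> c t \<longleftrightarrow>
     (\<forall>i. (deriv ^^ (k + 1)) (\<lambda>\<tau>. \<phi> (c \<tau>) $ i) t
            + fact (k + 1) * spray_coeff k f (curve_coords \<phi> k c t) $ i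
          = fact k / 2 * F (curve_coords \<phi> k c t) $ i)"

end

theory Submission
  imports Defs
begin

text \<open>In a chart, along a curve, the chain rule splits the time derivative of
  \<open>\<partial>L/\<partial>y\<^sup>(\<^sup>k\<^sup>)\<^sup>i\<close> into two parts. The coordinates
  \<open>y\<^sup>(\<^sup>\<alpha>\<^sup>)\<close> with \<open>\<alpha> < k\<close> have derivative \<open>(\<alpha> + 1) y\<^sup>(\<^sup>\<alpha>\<^sup>+\<^sup>1\<^sup>)\<close>, and
  their contributions add up to \<open>\<Gamma>(\<partial>L/\<partial>y\<^sup>(\<^sup>k\<^sup>)\<^sup>i)\<close>. The last coordinate has derivative
  \<open>x\<^sup>(\<^sup>k\<^sup>+\<^sup>1\<^sup>)/k!\<close> and contributes \<open>(2/k!) g\<^sub>j\<^sub>i x\<^sup>(\<^sup>k\<^sup>+\<^sup>1\<^sup>)\<^sup>j\<close>. This is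
  \<open>deriv_along_curve_coords\<close>. As \<open>g\<close> is symmetric, with \<open>e\<^sub>i = \<Gamma>(\<partial>L/\<partial>y\<^sup>(\<^sup>k\<^sup>)\<^sup>i) - \<partial>L/\<partial>y\<^sup>(\<^sup>k\<^sup>-\<^sup>1\<^sup>)\<^sup>i\<close> the
  Lagrange equations at time \<open>t\<close> therefore read \<open>e + (2/k!) g x\<^sup>(\<^sup>k\<^sup>+\<^sup>1\<^sup>) = g F\<close>, and
  multiplying by \<open>(k!/2) g\<^sup>-\<^sup>1\<close> turns them into the second system
  (\<open>solve_by_matrix_inv\<close>, \<open>lagrange_iff_spray\<close>). The equivalence thus holds at each time separately.

  Three points need work. The smoothness of \<open>L\<close> is given through partial derivatives on a coordinate
  space of sequences, so the chain rule has to be derived from continuity of the partial derivatives: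
  the coordinates are changed one after the other, and the mean value theorem is applied to each
  change (\<open>chain_rule_along_flows\<close>). The covariant force contains \<open>g\<^sub>i\<^sub>j\<close> where the chain
  rule produces \<open>g\<^sub>j\<^sub>i\<close>, so the symmetry of second derivatives is needed
  (\<open>mixed_pderiv_along_commute\<close>, \<open>metric_symmetric\<close>). Finally, smoothness of \<open>L\<close> and
  invertibility of \<open>g\<close> are known only off the null section, so the jets of the curve have to be
  located there in coordinates: if all \<open>y\<^sup>(\<^sup>\<alpha>\<^sup>)\<close> with \<open>\<alpha> \<ge> 1\<close> vanished, the jet would
  be that of a constant curve (\<open>curve_coords_in_slit_jet_domain\<close>).\<close>

section \<open>Differential calculus along flows\<close>

text \<open>Partial derivatives are taken along displacements of one coordinate, which form a flow. The set
  \<open>E\<close> stands for an invariant subspace in which the domains of interest are relatively open; they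
  need not be open in the whole space.\<close>

locale flow =
  fixes h :: "real \<Rightarrow> 'u::topological_space \<Rightarrow> 'u" and E :: "'u set"
  assumes flow_zero: "h 0 u = u"
    and flow_add: "h (a + b) u = h a (h b u)"
    and flow_continuous: "continuous_on UNIV (\<lambda>(s, u). h s u)"
    and flow_invariant: "u \<in> E \<Longrightarrow> h s u \<in> E"

lemma (in flow) tendsto_flow:
  assumes "(q \<longlongrightarrow> a) G" "(v \<longlongrightarrow> u) G"
  shows "((\<lambda>\<tau>. h (q \<tau>) (v \<tau>)) \<longlongrightarrow> h a u) G"
proof -
  have "((\<lambda>\<tau>. (\<lambda>(s, u). h s u) (q \<tau>, v \<tau>)) \<longlongrightarrow> (\<lambda>(s, u). h s u) (a, u)) G"
    by (rule continuous_on_tendsto_compose[OF flow_continuous tendsto_Pair[OF assms]]) auto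
  then show ?thesis by simp
qed

text \<open>Joint continuity at \<open>(0, u)\<close> gives a neighbourhood of product form, in which all intermediate
  points of a short displacement stay in the domain.\<close>

lemma (in flow) flow_box:
  assumes W: "openin (top_of_set E) W" and u: "u \<in> W"
  obtains e Q where "e > 0" "open Q" "u \<in> Q"
    and "\<And>s v. \<bar>s\<bar> < e \<Longrightarrow> v \<in> Q \<Longrightarrow> v \<in> E \<Longrightarrow> h s v \<in> W"
proof -
  obtain V where V: "open V" "W = E \<inter> V"
    using W by (auto simp: openin_open)
  have "open ((\<lambda>(s, u). h s u) -` V)"
    using flow_continuous V(1) by (simp add: continuous_on_open_vimage)
  moreover have "(0, u) \<in> (\<lambda>(s, u). h s u) -` V"
    using u V flow_zero by auto
  ultimately obtain P Q where PQ: "open P" "open Q" "(0, u) \<in> P \<times> Q"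
    "P \<times> Q \<subseteq> (\<lambda>(s, u). h s u) -` V"
    by (rule open_prod_elim)
  from PQ obtain e where e: "e > 0" "ball 0 e \<subseteq> P"
    by (auto simp: open_contains_ball)
  show ?thesis
  proof (rule that[OF e(1) PQ(2)])
    show "u \<in> Q" using PQ(3) by simp
    fix s :: real and v assume "\<bar>s\<bar> < e" "v \<in> Q" "v \<in> E"
    then have "(s, v) \<in> P \<times> Q" using e(2) by auto
    then show "h s v \<in> W"
      using PQ(4) V(2) \<open>v \<in> E\<close> flow_invariant by auto
  qed
qed

text \<open>The group law carries the derivative at parameter \<open>0\<close> over to every parameter, so \<open>f\<close> restricted
  to an orbit is an ordinary differentiable function.\<close>

lemma (in flow) has_derivative_along_flow:
  assumes "(\<lambda>a. f (h a (h s u))) field_differentiable at 0"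
  shows "((\<lambda>s. f (h s u)) has_real_derivative pderiv_along h f (h s u)) (at s)"
proof -
  have "((\<lambda>a. f (h a (h s u))) has_real_derivative pderiv_along h f (h s u)) (at 0)"
    unfolding pderiv_along_def using assms DERIV_deriv_iff_field_differentiable by blast
  then have "((\<lambda>a. f (h (a + s) u)) has_real_derivative pderiv_along h f (h s u)) (at 0)"
    by (simp add: flow_add)
  then show ?thesis
    using DERIV_shift[of "\<lambda>s. f (h s u)" _ 0 s] by simp
qed

lemma (in flow) mean_value_along_flow:
  assumes "\<And>s. \<bar>s\<bar> \<le> \<bar>d\<bar> \<Longrightarrow> (\<lambda>a. f (h a (h s u))) field_differentiable at 0"
  shows "\<exists>s. \<bar>s\<bar> \<le> \<bar>d\<bar> \<and> f (h d u) - f u = d * pderiv_along h f (h s u)"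
proof -
  have D: "((\<lambda>s. f (h s u)) has_real_derivative pderiv_along h f (h s u)) (at s)"
    if "\<bar>s\<bar> \<le> \<bar>d\<bar>" for s
    using assms[OF that] by (rule has_derivative_along_flow)
  consider "d = 0" | "d > 0" | "d < 0" by linarith
  then show ?thesis
  proof cases
    case 1
    then show ?thesis by (auto simp: flow_zero)
  next
    case 2
    then have "\<exists>z>0. z < d \<and> f (h d u) - f (h 0 u) = (d - 0) * pderiv_along h f (h z u)"
      using D by (intro MVT2) auto
    then obtain z where "0 < z" "z < d" "f (h d u) - f u = d * pderiv_along h f (h z u)"
      by (auto simp: flow_zero)
    then show ?thesis by (intro exI[of _ z]) auto
  next
    case 3
    then have "\<exists>z>d. z < 0 \<and> f (h 0 u) - f (h d u) = (0 - d) * pderiv_along h f (h z u)"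
      using D by (intro MVT2) auto
    then obtain z where "d < z" "z < 0" "f u - f (h d u) = - d * pderiv_along h f (h z u)"
      by (auto simp: flow_zero)
    then show ?thesis by (intro exI[of _ z]) auto
  qed
qed

text \<open>One coordinate at a time: the base point \<open>v \<tau>\<close> of the increment moves as well, and the difference
  quotient still tends to the partial derivative at \<open>u\<close>, because the mean value theorem places it at a
  point between \<open>v \<tau>\<close> and \<open>h (d \<tau>) (v \<tau>)\<close> and the partial derivative is continuous.\<close>

lemma (in flow) increment_along_flow:
  assumes W: "openin (top_of_set E) W" and u: "u \<in> W"
    and diff: "\<And>v. v \<in> W \<Longrightarrow> (\<lambda>s. f (h s v)) field_differentiable at 0"
    and cont: "continuous_on W (pderiv_along h f)"
    and v: "(v \<longlongrightarrow> u) G" "\<forall>\<^sub>F \<tau> in G. v \<tau> \<in> E" and d: "(d \<longlongrightarrow> 0) G"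
  obtains q where "(q \<longlongrightarrow> pderiv_along h f u) G"
    and "\<forall>\<^sub>F \<tau> in G. f (h (d \<tau>) (v \<tau>)) - f (v \<tau>) = d \<tau> * q \<tau>"
proof -
  let ?good = "\<lambda>\<tau>. \<forall>s. \<bar>s\<bar> \<le> \<bar>d \<tau>\<bar> \<longrightarrow> h s (v \<tau>) \<in> W"
  have good: "\<forall>\<^sub>F \<tau> in G. ?good \<tau>"
  proof -
    obtain e Q where box: "e > 0" "open Q" "u \<in> Q"
      "\<And>s v. \<bar>s\<bar> < e \<Longrightarrow> v \<in> Q \<Longrightarrow> v \<in> E \<Longrightarrow> h s v \<in> W"
      using flow_box[OF W u] by metis
    have "\<forall>\<^sub>F \<tau> in G. \<bar>d \<tau>\<bar> < e"
      using d box(1) tendstoD by fastforce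
    moreover have "\<forall>\<^sub>F \<tau> in G. v \<tau> \<in> Q"
      by (rule topological_tendstoD[OF v(1) box(2,3)])
    ultimately show ?thesis
      using v(2) by eventually_elim (auto intro: box(4))
  qed
  have "\<exists>s. \<bar>s\<bar> \<le> \<bar>d \<tau>\<bar> \<and>
      (?good \<tau> \<longrightarrow> f (h (d \<tau>) (v \<tau>)) - f (v \<tau>) = d \<tau> * pderiv_along h f (h s (v \<tau>)))" for \<tau>
  proof (cases "?good \<tau>")
    case True
    then show ?thesis using mean_value_along_flow[of "d \<tau>" f "v \<tau>"] diff by blast
  next
    case False
    then show ?thesis by (intro exI[of _ 0]) auto
  qed
  then obtain s where s: "\<And>\<tau>. \<bar>s \<tau>\<bar> \<le> \<bar>d \<tau>\<bar>"
    "\<And>\<tau>. ?good \<tau> \<Longrightarrow> f (h (d \<tau>) (v \<tau>)) - f (v \<tau>) = d \<tau> * pderiv_along h f (h (s \<tau>) (v \<tau>))"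
    by metis
  have "(s \<longlongrightarrow> 0) G"
    by (rule Lim_null_comparison[OF _ tendsto_rabs_zero[OF d]]) (simp add: s(1))
  from tendsto_flow[OF this v(1)] have "((\<lambda>\<tau>. h (s \<tau>) (v \<tau>)) \<longlongrightarrow> u) G"
    by (simp add: flow_zero)
  then have "((\<lambda>\<tau>. pderiv_along h f (h (s \<tau>) (v \<tau>))) \<longlongrightarrow> pderiv_along h f u) G"
    by (rule continuous_on_tendsto_compose[OF cont _ u])
      (use good s(1) in \<open>auto elim: eventually_mono\<close>)
  moreover have "\<forall>\<^sub>F \<tau> in G. f (h (d \<tau>) (v \<tau>)) - f (v \<tau>) = d \<tau> * pderiv_along h f (h (s \<tau>) (v \<tau>))"
    using good s(2) by (auto elim: eventually_mono)
  ultimately show ?thesis by (rule that)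
qed

text \<open>The composite of the displacements in \<open>xs\<close> describes a curve through \<open>u\<close>. In the induction the
  displacement by the first entry starts from the moving point reached by the other ones, which is the
  situation of \<open>increment_along_flow\<close>.\<close>

lemma chain_rule_along_flows:
  fixes H :: "'i \<Rightarrow> real \<Rightarrow> 'u::topological_space \<Rightarrow> 'u" and t :: real
  assumes flows: "\<And>i. i \<in> set xs \<Longrightarrow> flow (H i) E"
    and W: "openin (top_of_set E) W" and u: "u \<in> W"
    and diff: "\<And>i v. i \<in> set xs \<Longrightarrow> v \<in> W \<Longrightarrow> (\<lambda>s. f (H i s v)) field_differentiable at 0"
    and cont: "\<And>i. i \<in> set xs \<Longrightarrow> continuous_on W (pderiv_along (H i) f)"
    and d: "\<And>i. i \<in> set xs \<Longrightarrow> (d i has_real_derivative d' i) (at t)"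
    and d0: "\<And>i. i \<in> set xs \<Longrightarrow> d i t = 0"
  shows "((\<lambda>\<tau>. f (foldr (\<lambda>i. H i (d i \<tau>)) xs u)) has_real_derivative
            (\<Sum>i\<leftarrow>xs. d' i * pderiv_along (H i) f u)) (at t)"
proof -
  have "u \<in> E" using W u openin_imp_subset by blast
  define \<gamma> where "\<gamma> xs \<tau> = foldr (\<lambda>i. H i (d i \<tau>)) xs u" for xs \<tau>
  have "\<gamma> xs t = u \<and> (\<gamma> xs \<longlongrightarrow> u) (at t) \<and> (\<forall>\<tau>. \<gamma> xs \<tau> \<in> E) \<and>
      ((\<lambda>\<tau>. f (\<gamma> xs \<tau>)) has_real_derivative (\<Sum>i\<leftarrow>xs. d' i * pderiv_along (H i) f u)) (at t)"
    using flows diff cont d d0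
  proof (induction xs)
    case Nil
    then show ?case using \<open>u \<in> E\<close> by (simp add: \<gamma>_def)
  next
    case (Cons i xs)
    interpret flow "H i" E using Cons.prems(1) by simp
    have IH: "\<gamma> xs t = u" "(\<gamma> xs \<longlongrightarrow> u) (at t)" "\<And>\<tau>. \<gamma> xs \<tau> \<in> E"
      "((\<lambda>\<tau>. f (\<gamma> xs \<tau>)) has_real_derivative (\<Sum>i\<leftarrow>xs. d' i * pderiv_along (H i) f u)) (at t)"
      using Cons by simp_all
    have step: "\<gamma> (i # xs) = (\<lambda>\<tau>. H i (d i \<tau>) (\<gamma> xs \<tau>))"
      by (auto simp: \<gamma>_def)
    have di: "(d i has_real_derivative d' i) (at t)" and di0: "d i t = 0"
      using Cons.prems by simp_all
    have dlim: "(d i \<longlongrightarrow> 0) (at t)"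
      using DERIV_isCont[OF di] di0 by (simp add: isCont_def)
    have at: "\<gamma> (i # xs) t = u"
      by (simp add: step IH di0 flow_zero)
    have lim: "(\<gamma> (i # xs) \<longlongrightarrow> u) (at t)"
      using tendsto_flow[OF dlim IH(2)] by (simp add: step flow_zero)
    obtain q where q: "(q \<longlongrightarrow> pderiv_along (H i) f u) (at t)"
      "\<forall>\<^sub>F \<tau> in at t. f (H i (d i \<tau>) (\<gamma> xs \<tau>)) - f (\<gamma> xs \<tau>) = d i \<tau> * q \<tau>"
      by (rule increment_along_flow[OF W u _ _ IH(2) _ dlim, of f])
        (use Cons.prems IH(3) in auto)
    have "((\<lambda>\<tau>. (d i \<tau> - d i t) / (\<tau> - t) * q \<tau> + (f (\<gamma> xs \<tau>) - f (\<gamma> xs t)) / (\<tau> - t)) \<longlongrightarrow>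
        d' i * pderiv_along (H i) f u + (\<Sum>i\<leftarrow>xs. d' i * pderiv_along (H i) f u)) (at t)"
      using di IH(4) q(1) unfolding has_field_derivative_iff by (intro tendsto_intros)
    moreover have "\<forall>\<^sub>F \<tau> in at t.
        (d i \<tau> - d i t) / (\<tau> - t) * q \<tau> + (f (\<gamma> xs \<tau>) - f (\<gamma> xs t)) / (\<tau> - t)
        = (f (\<gamma> (i # xs) \<tau>) - f (\<gamma> (i # xs) t)) / (\<tau> - t)"
      using q(2)
    proof eventually_elim
      case (elim \<tau>)
      have "f (\<gamma> (i # xs) \<tau>) = d i \<tau> * q \<tau> + f (\<gamma> xs \<tau>)"
        using elim by (simp add: step)
      then show ?case unfolding at IH(1)
        by (simp add: di0 add_divide_distrib diff_divide_distrib)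
    qed
    ultimately have "((\<lambda>\<tau>. (f (\<gamma> (i # xs) \<tau>) - f (\<gamma> (i # xs) t)) / (\<tau> - t)) \<longlongrightarrow>
        (\<Sum>i\<leftarrow>i # xs. d' i * pderiv_along (H i) f u)) (at t)"
      by (auto elim: Lim_transform_eventually)
    then have "((\<lambda>\<tau>. f (\<gamma> (i # xs) \<tau>)) has_real_derivative
        (\<Sum>i\<leftarrow>i # xs. d' i * pderiv_along (H i) f u)) (at t)"
      unfolding has_field_derivative_iff .
    moreover have "\<forall>\<tau>. \<gamma> (i # xs) \<tau> \<in> E"
      using IH(3) flow_invariant by (simp add: step)
    ultimately show ?case
      using at lim by blast
  qed
  then show ?thesis by (simp add: \<gamma>_def)
qed

text \<open>The second difference is symmetric in the two flows, while its limit is computed by two mean value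
  theorems, first along \<open>g\<close> and then along \<open>h\<close>. This makes the limit one of the two mixed
  derivatives, and exchanging the flows gives the other.\<close>

lemma second_difference_limit:
  assumes flow_g: "flow g E" and flow_h: "flow h E"
    and comm: "\<And>a b v. g a (h b v) = h b (g a v)"
    and W: "openin (top_of_set E) W" and u: "u \<in> W"
    and C2: "Cr_on 2 {g, h} W f"
  shows "((\<lambda>s. (f (h s (g s u)) - f (g s u) - f (h s u) + f u) / s\<^sup>2) \<longlongrightarrow>
           pderiv_along h (pderiv_along g f) u) (at 0)"
proof -
  interpret g: flow g E by (rule flow_g)
  interpret h: flow h E by (rule flow_h)
  have diff_g: "\<And>v. v \<in> W \<Longrightarrow> (\<lambda>s. f (g s v)) field_differentiable at 0"
    and diff_hg: "\<And>v. v \<in> W \<Longrightarrow> (\<lambda>s. pderiv_along g f (h s v)) field_differentiable at 0"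
    and cont: "continuous_on W (pderiv_along h (pderiv_along g f))"
    using C2 by (simp_all add: numeral_2_eq_2)
  have "u \<in> E" using W u openin_imp_subset by blast
  obtain e Q where box_h: "e > 0" "open Q" "u \<in> Q"
    "\<And>b v. \<bar>b\<bar> < e \<Longrightarrow> v \<in> Q \<Longrightarrow> v \<in> E \<Longrightarrow> h b v \<in> W"
    using h.flow_box[OF W u] by metis
  have "openin (top_of_set E) (E \<inter> Q)" "u \<in> E \<inter> Q"
    using box_h(2,3) \<open>u \<in> E\<close> by auto
  then obtain e' Q' where box_g: "e' > 0" "u \<in> Q'"
    "\<And>a v. \<bar>a\<bar> < e' \<Longrightarrow> v \<in> Q' \<Longrightarrow> v \<in> E \<Longrightarrow> g a v \<in> E \<inter> Q"
    using g.flow_box by metis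
  define r where "r = min e e'"
  have r: "r > 0" using box_h(1) box_g(1) by (simp add: r_def)
  have inW: "h b (g a u) \<in> W" if "\<bar>a\<bar> < r" "\<bar>b\<bar> < r" for a b
    using that box_h(4) box_g(2,3) \<open>u \<in> E\<close> by (simp add: r_def)
  have inW0: "g a u \<in> W" if "\<bar>a\<bar> < r" for a
    using inW[OF that, of 0] r by (simp add: h.flow_zero)
  let ?\<Delta> = "\<lambda>s. f (h s (g s u)) - f (g s u) - f (h s u) + f u"
  have "\<exists>a b. \<bar>a\<bar> \<le> \<bar>s\<bar> \<and> \<bar>b\<bar> \<le> \<bar>s\<bar> \<and>
      (\<bar>s\<bar> < r \<longrightarrow> ?\<Delta> s = s\<^sup>2 * pderiv_along h (pderiv_along g f) (h b (g a u)))" for s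
  proof (cases "\<bar>s\<bar> < r")
    case True
    \<comment> \<open>The second difference is the increment along \<open>g\<close> of the increment along \<open>h\<close>.\<close>
    define \<Phi> where "\<Phi> v = f (h s v) - f v" for v
    have hs: "(\<lambda>x. f (h s (g x (g a u)))) field_differentiable at 0"
      and nohs: "(\<lambda>x. f (g x (g a u))) field_differentiable at 0" if "\<bar>a\<bar> \<le> \<bar>s\<bar>" for a
      using that True diff_g[of "h s (g a u)"] diff_g[of "g a u"] inW[of a s] inW0[of a]
      by (simp_all add: comm)
    have "(\<lambda>x. \<Phi> (g x (g a u))) field_differentiable at 0" if "\<bar>a\<bar> \<le> \<bar>s\<bar>" for a
      unfolding \<Phi>_def by (intro field_differentiable_diff hs nohs that)
    then obtain a where a: "\<bar>a\<bar> \<le> \<bar>s\<bar>" "\<Phi> (g s u) - \<Phi> u = s * pderiv_along g \<Phi> (g a u)"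
      using g.mean_value_along_flow by blast
    have "pderiv_along g \<Phi> (g a u) = pderiv_along g f (h s (g a u)) - pderiv_along g f (g a u)"
      using deriv_diff[OF hs[OF a(1)] nohs[OF a(1)]]
      by (simp add: pderiv_along_def \<Phi>_def comm)
    moreover have "\<exists>b. \<bar>b\<bar> \<le> \<bar>s\<bar> \<and> pderiv_along g f (h s (g a u)) - pderiv_along g f (g a u)
        = s * pderiv_along h (pderiv_along g f) (h b (g a u))"
      using True a(1) by (intro h.mean_value_along_flow diff_hg inW) auto
    ultimately obtain b where b: "\<bar>b\<bar> \<le> \<bar>s\<bar>"
      "pderiv_along g \<Phi> (g a u) = s * pderiv_along h (pderiv_along g f) (h b (g a u))"
      by auto
    have "?\<Delta> s = \<Phi> (g s u) - \<Phi> u" by (simp add: \<Phi>_def)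
    also have "\<dots> = s\<^sup>2 * pderiv_along h (pderiv_along g f) (h b (g a u))"
      unfolding a(2) b(2) by (simp add: power2_eq_square)
    finally show ?thesis using a(1) b(1) by blast
  next
    case False
    then show ?thesis by (intro exI[of _ 0]) auto
  qed
  then obtain a b where ab: "\<And>s. \<bar>a s\<bar> \<le> \<bar>s\<bar>" "\<And>s. \<bar>b s\<bar> \<le> \<bar>s\<bar>"
    "\<And>s. \<bar>s\<bar> < r \<Longrightarrow> ?\<Delta> s = s\<^sup>2 * pderiv_along h (pderiv_along g f) (h (b s) (g (a s) u))"
    by metis
  have to0: "(q \<longlongrightarrow> 0) (at 0)" if "\<And>s. \<bar>q s\<bar> \<le> \<bar>s\<bar>" for q :: "real \<Rightarrow> real"
    by (rule Lim_null_comparison[OF _ tendsto_rabs_zero[OF tendsto_ident_at]]) (simp add: that)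
  have small: "\<forall>\<^sub>F s in at 0. \<bar>s\<bar> < r \<and> s \<noteq> (0::real)"
    unfolding eventually_at using r by (intro exI[of _ r]) auto
  have "((\<lambda>s. h (b s) (g (a s) u)) \<longlongrightarrow> h 0 (g 0 u)) (at 0)"
    by (intro h.tendsto_flow g.tendsto_flow to0 ab tendsto_const)
  then have "((\<lambda>s. h (b s) (g (a s) u)) \<longlongrightarrow> u) (at 0)"
    by (simp add: h.flow_zero g.flow_zero)
  then have "((\<lambda>s. pderiv_along h (pderiv_along g f) (h (b s) (g (a s) u))) \<longlongrightarrow>
      pderiv_along h (pderiv_along g f) u) (at 0)"
  proof (rule continuous_on_tendsto_compose[OF cont _ u])
    show "\<forall>\<^sub>F s in at 0. h (b s) (g (a s) u) \<in> W"
      using small by eventually_elim (meson ab(1,2) inW order_le_less_trans)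
  qed
  moreover have "\<forall>\<^sub>F s in at 0.
      pderiv_along h (pderiv_along g f) (h (b s) (g (a s) u)) = ?\<Delta> s / s\<^sup>2"
    using small by eventually_elim (simp add: ab(3))
  ultimately show ?thesis by (rule Lim_transform_eventually)
qed

lemma mixed_pderiv_along_commute:
  assumes "flow g E" and "flow h E"
    and comm: "\<And>a b v. g a (h b v) = h b (g a v)"
    and "openin (top_of_set E) W" and "u \<in> W"
    and C2: "Cr_on 2 {g, h} W f"
  shows "pderiv_along g (pderiv_along h f) u = pderiv_along h (pderiv_along g f) u"
proof -
  have "((\<lambda>s. (f (g s (h s u)) - f (h s u) - f (g s u) + f u) / s\<^sup>2) \<longlongrightarrow>
      pderiv_along g (pderiv_along h f) u) (at 0)"
    using assms by (intro second_difference_limit) (simp_all add: insert_commute)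
  then have "((\<lambda>s. (f (h s (g s u)) - f (g s u) - f (h s u) + f u) / s\<^sup>2) \<longlongrightarrow>
      pderiv_along g (pderiv_along h f) u) (at 0)"
    by (simp add: comm algebra_simps)
  then show ?thesis
    using second_difference_limit[OF assms] LIM_unique by blast
qed

section \<open>Calculus in jet coordinates\<close>

text \<open>The coordinate domains are not open among all sequences, but they are relatively open here.\<close>

definition jet_space :: "nat \<Rightarrow> (nat \<Rightarrow> real^'n::finite) set" where
  "jet_space k = {u. \<forall>\<alpha>>k. u \<alpha> = 0}"

lemma flow_jet_displace:
  assumes "\<alpha> \<le> k"
  shows "flow (jet_displace \<alpha> i) (jet_space k :: (nat \<Rightarrow> real^'n::finite) set)"
proof
  have "continuous_on UNIV (\<lambda>p :: real \<times> (nat \<Rightarrow> real^'n). jet_displace \<alpha> i (fst p) (snd p) \<beta>)" for \<beta>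
  proof -
    have coord: "continuous_on UNIV (\<lambda>p :: real \<times> (nat \<Rightarrow> real^'n). snd p \<beta>)"
      by (rule continuous_on_compose2[OF continuous_on_product_coordinates continuous_on_snd])
        (rule continuous_on_id, simp)
    have "continuous_on UNIV (\<lambda>p :: real \<times> (nat \<Rightarrow> real^'n). snd p \<beta> + fst p *\<^sub>R axis i 1)"
      by (intro continuous_on_add coord continuous_on_scaleR continuous_on_fst
          continuous_on_id continuous_on_const)
    with coord show ?thesis
      by (cases "\<beta> = \<alpha>") (simp_all add: jet_displace_def displace_def)
  qed
  then show "continuous_on UNIV (\<lambda>(s, u :: nat \<Rightarrow> real^'n). jet_displace \<alpha> i s u)"
    unfolding case_prod_unfold by (intro continuous_on_coordinatewise_then_product)
qed (use assms in \<open>auto simp: jet_space_def jet_displace_def displace_def algebra_simps\<close>)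

lemma jet_displace_commute:
  "jet_displace \<alpha> i a (jet_displace \<beta> j b u) = jet_displace \<beta> j b (jet_displace \<alpha> i a u)"
  by (auto simp: jet_displace_def displace_def fun_eq_iff)

lemma openin_slit_jet_domain:
  fixes \<phi> :: "'m \<Rightarrow> real^'n::finite"
  assumes "open (\<phi> ` U)"
  shows "openin (top_of_set (jet_space k)) (slit_jet_domain (U, \<phi>) k)"
proof -
  have coord: "open ((\<lambda>u :: nat \<Rightarrow> real^'n. u \<alpha>) -` S)" if "open S" for \<alpha> S
    using that by (intro open_vimage continuous_on_product_coordinates)
  have "open ((\<lambda>u. u 0) -` (\<phi> ` U) \<inter> (\<Union>\<alpha>\<in>{1..k}. (\<lambda>u. u \<alpha>) -` (- {0})))"
    by (intro open_Int open_UN ballI coord assms open_Compl closed_singleton)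
  moreover have "slit_jet_domain (U, \<phi>) k =
      jet_space k \<inter> ((\<lambda>u. u 0) -` (\<phi> ` U) \<inter> (\<Union>\<alpha>\<in>{1..k}. (\<lambda>u. u \<alpha>) -` (- {0})))"
    by (auto simp: slit_jet_domain_def jet_domain_def jet_space_def)
  ultimately show ?thesis by (metis openin_open)
qed

text \<open>Any change of finitely many coordinates is a composite of displacements, so that
  \<open>chain_rule_along_flows\<close> applies to arbitrary curves in the jet coordinates. Distinctness makes
  every coordinate move only once.\<close>

lemma foldr_jet_displace:
  assumes "distinct xs"
  shows "foldr (\<lambda>(\<alpha>, i). jet_displace \<alpha> i (d (\<alpha>, i))) xs u \<alpha> $ i =
           u \<alpha> $ i + (if (\<alpha>, i) \<in> set xs then d (\<alpha>, i) else 0)"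
  using assms
proof (induction xs)
  case (Cons p xs)
  obtain \<beta> j where p: "p = (\<beta>, j)" by (cases p)
  have step: "jet_displace \<beta> j s v \<alpha> $ i = v \<alpha> $ i + (if \<alpha> = \<beta> \<and> i = j then s else 0)" for s v
    by (simp add: jet_displace_def displace_def axis_def)
  show ?case
    using Cons by (auto simp: p step)
qed simp

lemma jet_chain_rule:
  fixes y :: "real \<Rightarrow> nat \<Rightarrow> real^'n::finite"
  assumes W: "openin (top_of_set (jet_space k)) W" and yt: "y t \<in> W"
    and C1: "Cr_on 1 {jet_displace \<alpha> i |\<alpha> i. \<alpha> \<le> k} W f"
    and y: "\<And>\<tau>. y \<tau> \<in> jet_space k"
    and y': "\<And>\<alpha> i. \<alpha> \<le> k \<Longrightarrow> ((\<lambda>\<tau>. y \<tau> \<alpha> $ i) has_real_derivative y' \<alpha> i) (at t)"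
  shows "((\<lambda>\<tau>. f (y \<tau>)) has_real_derivative
           (\<Sum>\<alpha>\<le>k. \<Sum>i\<in>UNIV. y' \<alpha> i * jet_partial \<alpha> i f (y t))) (at t)"
proof -
  obtain xs :: "(nat \<times> 'n) list" where xs: "set xs = {..k} \<times> UNIV" "distinct xs"
    using finite_distinct_list[of "{..k} \<times> (UNIV :: 'n set)"] by auto
  define H :: "nat \<times> 'n \<Rightarrow> real \<Rightarrow> (nat \<Rightarrow> real^'n) \<Rightarrow> nat \<Rightarrow> real^'n"
    where "H = (\<lambda>(\<alpha>, i). jet_displace \<alpha> i)"
  define d where "d = (\<lambda>(\<alpha>, i) \<tau>. y \<tau> \<alpha> $ i - y t \<alpha> $ i)"
  have path: "foldr (\<lambda>p. H p (d p \<tau>)) xs (y t) = y \<tau>" for \<tau>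
  proof -
    have "foldr (\<lambda>p. H p (d p \<tau>)) xs (y t) =
        foldr (\<lambda>(\<alpha>, i). jet_displace \<alpha> i (d (\<alpha>, i) \<tau>)) xs (y t)"
      by (simp add: H_def case_prod_unfold)
    also have "\<dots> = y \<tau>"
    proof (intro ext, unfold vec_eq_iff, intro allI)
      fix \<alpha> i
      show "foldr (\<lambda>(\<alpha>, i). jet_displace \<alpha> i (d (\<alpha>, i) \<tau>)) xs (y t) \<alpha> $ i = y \<tau> \<alpha> $ i"
        using y[of \<tau>] y[of t]
        unfolding foldr_jet_displace[OF xs(2), of "\<lambda>p. d p \<tau>"]
        by (simp add: xs(1) d_def jet_space_def)
    qed
    finally show ?thesis .
  qed
  have "((\<lambda>\<tau>. f (foldr (\<lambda>p. H p (d p \<tau>)) xs (y t))) has_real_derivative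
      (\<Sum>p\<leftarrow>xs. case_prod y' p * pderiv_along (H p) f (y t))) (at t)"
  proof (rule chain_rule_along_flows[OF _ W yt])
    fix p assume "p \<in> set xs"
    then obtain \<alpha> i where p: "p = (\<alpha>, i)" "\<alpha> \<le> k" using xs(1) by auto
    show "flow (H p) (jet_space k)"
      by (simp add: p H_def flow_jet_displace)
    have H: "H p \<in> {jet_displace \<alpha> i |\<alpha> i. \<alpha> \<le> k}"
      using p by (auto simp: H_def)
    show "(\<lambda>s. f (H p s v)) field_differentiable at 0" if "v \<in> W" for v
      using C1 H that unfolding One_nat_def Cr_on.simps by blast
    show "continuous_on W (pderiv_along (H p) f)"
      using C1 H unfolding One_nat_def Cr_on.simps by blast
    show "(d p has_real_derivative case_prod y' p) (at t)"
      using DERIV_diff[OF y'[OF p(2), of i] DERIV_const] by (simp add: d_def p(1))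
    show "d p t = 0" by (simp add: d_def p(1))
  qed
  moreover have "(\<Sum>p\<leftarrow>xs. case_prod y' p * pderiv_along (H p) f (y t)) =
      (\<Sum>\<alpha>\<le>k. \<Sum>i\<in>UNIV. y' \<alpha> i * jet_partial \<alpha> i f (y t))"
    unfolding sum_list_distinct_conv_sum_set[OF xs(2)] xs(1) sum.cartesian_product
    by (intro sum.cong refl) (auto simp: H_def jet_partial_def)
  ultimately show ?thesis by (simp add: path)
qed

lemma Cr_on_subset:
  assumes "H' \<subseteq> H"
  shows "Cr_on r H W f \<Longrightarrow> Cr_on r H' W f"
proof (induction r arbitrary: f)
  case (Suc r)
  have 1: "continuous_on W f"
    "\<And>h. h \<in> H' \<Longrightarrow> \<forall>u\<in>W. (\<lambda>s. f (h s u)) field_differentiable at 0"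
    "\<And>h. h \<in> H' \<Longrightarrow> Cr_on r H W (pderiv_along h f)"
    using Suc.prems assms by auto
  show ?case
    using 1 Suc.IH by simp
qed simp

lemma metric_symmetric:
  assumes W: "openin (top_of_set (jet_space k)) W" and u: "u \<in> W" and f: "jet_smooth_on k W f"
  shows "metric k f u $ i $ j = metric k f u $ j $ i"
proof -
  have "Cr_on 2 {jet_displace \<alpha> i |\<alpha> i. \<alpha> \<le> k} W f"
    using f by (simp add: jet_smooth_on_def smooth_along_def)
  then have "Cr_on 2 {jet_displace k i, jet_displace k j} W f"
    by (rule Cr_on_subset[rotated]) auto
  from mixed_pderiv_along_commute[OF flow_jet_displace flow_jet_displace jet_displace_commute W u this]
  show ?thesis by (simp add: metric_def jet_partial_def)
qed

text \<open>The coordinates of a lifted curve satisfy \<open>dy\<^sup>(\<^sup>\<alpha>\<^sup>)/dt = (\<alpha> + 1) y\<^sup>(\<^sup>\<alpha>\<^sup>+\<^sup>1\<^sup>)\<close> for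
  \<open>\<alpha> < k\<close>, and \<open>\<Gamma>\<close> collects these terms. Only the top coordinate brings in the derivative of order
  \<open>k + 1\<close>.\<close>

lemma deriv_along_curve_coords:
  fixes \<phi> :: "'m \<Rightarrow> real^'n::finite"
  assumes W: "openin (top_of_set (jet_space k)) W" and in_W: "curve_coords \<phi> k c t \<in> W"
    and C1: "Cr_on 1 {jet_displace \<alpha> i |\<alpha> i. \<alpha> \<le> k} W f"
    and diff: "\<And>\<alpha> i. \<alpha> \<le> k \<Longrightarrow> (deriv ^^ \<alpha>) (\<lambda>\<tau>. \<phi> (c \<tau>) $ i) field_differentiable at t"
  shows "deriv (\<lambda>\<tau>. f (curve_coords \<phi> k c \<tau>)) t =
           Gamma_op k f (curve_coords \<phi> k c t)
           + (\<Sum>i\<in>UNIV. (deriv ^^ (k + 1)) (\<lambda>\<tau>. \<phi> (c \<tau>) $ i) t / fact k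
                * jet_partial k i f (curve_coords \<phi> k c t))"
proof -
  define x where "x i = (\<lambda>\<tau>. \<phi> (c \<tau>) $ i)" for i
  let ?y = "curve_coords \<phi> k c"
  let ?y' = "\<lambda>\<alpha> i. (deriv ^^ Suc \<alpha>) (x i) t / fact \<alpha>"
  have y: "?y \<tau> \<alpha> $ i = (deriv ^^ \<alpha>) (x i) \<tau> / fact \<alpha>" if "\<alpha> \<le> k" for \<tau> \<alpha> i
    using that by (simp add: curve_coords_def x_def)
  have y': "((\<lambda>\<tau>. ?y \<tau> \<alpha> $ i) has_real_derivative ?y' \<alpha> i) (at t)" if "\<alpha> \<le> k" for \<alpha> i
  proof -
    have "((deriv ^^ \<alpha>) (x i) has_real_derivative deriv ((deriv ^^ \<alpha>) (x i)) t) (at t)"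
      using diff[OF that, of i] unfolding x_def DERIV_deriv_iff_field_differentiable .
    from DERIV_cdivide[OF this, of "fact \<alpha>"] show ?thesis
      unfolding y[OF that] by simp
  qed
  have "((\<lambda>\<tau>. f (?y \<tau>)) has_real_derivative
      (\<Sum>\<alpha>\<le>k. \<Sum>i\<in>UNIV. ?y' \<alpha> i * jet_partial \<alpha> i f (?y t))) (at t)"
  proof (rule jet_chain_rule[where y = ?y and t = t and y' = ?y', OF W in_W C1])
    show "?y \<tau> \<in> jet_space k" for \<tau>
      by (simp add: jet_space_def curve_coords_def)
  qed (rule y')
  then have "deriv (\<lambda>\<tau>. f (?y \<tau>)) t =
      (\<Sum>\<alpha>\<le>k. \<Sum>i\<in>UNIV. ?y' \<alpha> i * jet_partial \<alpha> i f (?y t))"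
    by (rule DERIV_imp_deriv)
  also have "\<dots> = (\<Sum>\<alpha><k. \<Sum>i\<in>UNIV. ?y' \<alpha> i * jet_partial \<alpha> i f (?y t))
      + (\<Sum>i\<in>UNIV. ?y' k i * jet_partial k i f (?y t))"
    unfolding lessThan_Suc_atMost[symmetric] sum.lessThan_Suc ..
  also have "(\<Sum>\<alpha><k. \<Sum>i\<in>UNIV. ?y' \<alpha> i * jet_partial \<alpha> i f (?y t)) = Gamma_op k f (?y t)"
    unfolding Gamma_op_def sum.atLeast1_atMost_eq[folded One_nat_def]
  proof (intro sum.cong refl)
    fix \<alpha> i assume "\<alpha> \<in> {..<k}"
    then have le: "Suc \<alpha> \<le> k" by simp
    have "real (Suc \<alpha>) * ?y t (Suc \<alpha>) $ i = ?y' \<alpha> i"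
      unfolding y[OF le] fact_Suc by (simp del: of_nat_Suc funpow.simps)
    then show "?y' \<alpha> i * jet_partial \<alpha> i f (?y t) =
        real (Suc \<alpha>) * ?y t (Suc \<alpha>) $ i * jet_partial (Suc \<alpha> - 1) i f (?y t)"
      by simp
  qed
  finally show ?thesis by (simp add: x_def)
qed

section \<open>Jets off the null section\<close>

lemma higher_deriv_shift:
  "(deriv ^^ m) (\<lambda>s. f (t + s)) s = (deriv ^^ m) f (t + s)" for f :: "real \<Rightarrow> real"
proof (induction m arbitrary: s)
  case (Suc m)
  have "(deriv ^^ m) (\<lambda>s. f (t + s)) = (\<lambda>s. (deriv ^^ m) f (t + s))"
    using Suc.IH by blast
  then have "(deriv ^^ Suc m) (\<lambda>s. f (t + s)) s = deriv (\<lambda>s. (deriv ^^ m) f (t + s)) s"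
    by simp
  also have "\<dots> = (deriv ^^ Suc m) f (t + s)"
    using DERIV_shift[of "(deriv ^^ m) f" _ s t]
    by (simp add: deriv_def add.commute)
  finally show ?case .
qed simp

lemma higher_deriv_const:
  "(deriv ^^ m) (\<lambda>_. a) = (\<lambda>_. if m = 0 then a else (0::real))"
  by (induction m) auto

lemma curve_coords_shift: "curve_coords \<phi> k (\<lambda>s. c (t + s)) 0 = curve_coords \<phi> k c t"
  by (simp add: curve_coords_def fun_eq_iff higher_deriv_shift[of _ "\<lambda>s. \<phi> (c s) $ _"])

lemma curve_coords_const:
  "curve_coords \<phi> k (\<lambda>_. p) s = (\<lambda>\<alpha>. if \<alpha> = 0 then \<phi> p else 0)"
  by (auto simp: curve_coords_def fun_eq_iff vec_eq_iff higher_deriv_const)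

text \<open>One order of differentiability is given up: differentiability of the \<open>k\<close>-th derivative provides
  its continuity.\<close>

lemma shifted_curve_germ:
  assumes c: "Cr_curve X A (k + 1) I c" and I: "open I" and t: "t \<in> I"
  shows "(\<lambda>s. c (t + s)) \<in> curve_germs X A k"
proof -
  obtain e where e: "e > 0" "ball t e \<subseteq> I"
    using I t open_contains_ball by blast
  have J: "t + s \<in> I" if "s \<in> {-e<..<e}" for s
    using that e(2) by (auto simp: dist_real_def)
  have "continuous_map (top_of_set {-e<..<e}) (top_of_set I) (\<lambda>s. t + s)"
    by (auto simp: J continuous_map_iff_continuous intro!: continuous_map_into_subtopology continuous_intros)
  then have "continuous_map (top_of_set {-e<..<e}) X (c \<circ> (\<lambda>s. t + s))"
    using c continuous_map_compose unfolding Cr_curve_def by blast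
  moreover have "Cr_real_on k {s\<in>{-e<..<e}. c (t + s) \<in> V} (\<lambda>s. \<psi> (c (t + s)) $ i)"
    if "(V, \<psi>) \<in> A" for V \<psi> i
  proof -
    define x where "x \<tau> = \<psi> (c \<tau>) $ i" for \<tau>
    have shift: "(deriv ^^ m) (\<lambda>s. \<psi> (c (t + s)) $ i) = (\<lambda>s. (deriv ^^ m) x (t + s))" for m
      using higher_deriv_shift[of m x t] by (simp add: x_def fun_eq_iff)
    have "\<forall>m<k+1. \<forall>\<tau>\<in>{t \<in> I. c t \<in> V}. (deriv ^^ m) x field_differentiable at \<tau>"
      using c that unfolding Cr_curve_def Cr_real_on_def x_def by blast
    then have "(deriv ^^ m) x field_differentiable at (s + t)"
      if "m \<le> k" "s \<in> {-e<..<e}" "c (t + s) \<in> V" for m s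
      using that J[of s] by (simp add: add.commute)
    then have "(\<lambda>s. (deriv ^^ m) x (t + s)) field_differentiable at s"
      if "m \<le> k" "s \<in> {-e<..<e}" "c (t + s) \<in> V" for m s
      using that unfolding field_differentiable_def DERIV_shift by (simp add: add.commute)
    then show ?thesis
      unfolding Cr_real_on_def shift
      by (auto intro!: continuous_at_imp_continuous_on field_differentiable_imp_continuous_at)
  qed
  ultimately show ?thesis
    using e(1) unfolding curve_germs_def Cr_curve_def by (auto simp: o_def)
qed

lemma constant_curve_germ:
  assumes "p \<in> topspace X"
  shows "(\<lambda>_. p) \<in> curve_germs X A k"
  unfolding curve_germs_def Cr_curve_def Cr_real_on_def
  using assms by (auto simp: higher_deriv_const intro!: exI[of _ 1])

text \<open>If the coordinates of positive order all vanished, the curve would have the coordinates, hence the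
  jet, of the constant curve at \<open>c t\<close>, and its jet would lie in the null section.\<close>

lemma curve_coords_in_slit_jet_domain:
  assumes c: "Cr_curve X A (k + 1) I c" and I: "open I" and t: "t \<in> I"
    and chart: "(U, \<phi>) \<in> A" "c t \<in> U"
    and slit: "jet X A k (\<lambda>s. c (t + s)) \<in> slit_acc_bundle X A k"
  shows "curve_coords \<phi> k c t \<in> slit_jet_domain (U, \<phi>) k"
proof -
  have "curve_coords \<phi> k c t 0 = \<phi> (c t)"
    by (simp add: curve_coords_def)
  then have dom: "curve_coords \<phi> k c t \<in> jet_domain (U, \<phi>) k"
    using chart(2) by (simp add: jet_domain_def curve_coords_def)
  have "\<exists>\<alpha>\<in>{1..k}. curve_coords \<phi> k c t \<alpha> \<noteq> 0"
  proof (rule ccontr)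
    assume "\<not> ?thesis"
    then have "curve_coords \<phi> k c t \<alpha> = 0" if "\<alpha> \<noteq> 0" for \<alpha>
      using that by (cases "\<alpha> \<le> k") (auto simp: curve_coords_def)
    then have "curve_coords \<phi> k c t = (\<lambda>\<alpha>. if \<alpha> = 0 then \<phi> (c t) else 0)"
      using \<open>curve_coords \<phi> k c t 0 = \<phi> (c t)\<close> by auto
    then have "curve_coords \<phi> k (\<lambda>s. c (t + s)) 0 = curve_coords \<phi> k (\<lambda>_. c t) 0"
      by (simp add: curve_coords_shift curve_coords_const)
    moreover have "c t \<in> topspace X"
      using c t continuous_map_image_subset_topspace unfolding Cr_curve_def by fastforce
    ultimately have "(\<lambda>s. c (t + s), \<lambda>_. c t) \<in> jet_rel X A k"
      using shifted_curve_germ[OF c I t] constant_curve_germ chart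
      unfolding jet_rel_def by auto
    then have "(\<lambda>_. c t) \<in> jet X A k (\<lambda>s. c (t + s))"
      by (simp add: jet_def)
    then show False
      using slit by (auto simp: slit_acc_bundle_def null_section_def)
  qed
  then show ?thesis using dom by (simp add: slit_jet_domain_def)
qed

section \<open>Solving for the highest derivative\<close>

lemma solve_by_matrix_inv:
  fixes g :: "real^'n^'n::finite"
  assumes g: "invertible g" and a: "a \<noteq> 0"
  shows "e + (1 / a) *\<^sub>R (g *v z) = g *v w \<longleftrightarrow> z + a *\<^sub>R (matrix_inv g *v e) = a *\<^sub>R w"
proof -
  have inv: "g *v (matrix_inv g *v v) = v" for v
    using someI_ex[OF g[unfolded invertible_def]]
    by (simp add: matrix_vector_mul_assoc matrix_inv_def)
  have inj: "g *v v = g *v v' \<longleftrightarrow> v = v'" for v v'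
    using g by (metis invertible_left_inverse matrix_left_invertible_injective injD)
  have "z + a *\<^sub>R (matrix_inv g *v e) = a *\<^sub>R w \<longleftrightarrow>
      g *v z + a *\<^sub>R e = a *\<^sub>R (g *v w)"
    unfolding inj[symmetric, of "z + _"]
    by (simp add: matrix_vector_right_distrib matrix_vector_mult_scaleR inv)
  also have "\<dots> \<longleftrightarrow> a *\<^sub>R (e + (1 / a) *\<^sub>R (g *v z)) = a *\<^sub>R (g *v w)"
    using a by (simp add: scaleR_add_right add.commute)
  also have "\<dots> \<longleftrightarrow> e + (1 / a) *\<^sub>R (g *v z) = g *v w"
    using a by simp
  finally show ?thesis by simp
qed

text \<open>The constants agree because \<open>(k + 1)! / (2 (k + 1)) = k! / 2\<close>, so that the two systems are
  \<open>e + (2/k!) g z = g F\<close> and \<open>z + (k!/2) g\<^sup>-\<^sup>1 e = (k!/2) F\<close>, where \<open>z\<close> is the derivative of order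
  \<open>k + 1\<close>.\<close>

lemma lagrange_iff_spray:
  fixes \<phi> :: "'m \<Rightarrow> real^'n::finite"
  assumes W: "openin (top_of_set (jet_space k)) W" and in_W: "curve_coords \<phi> k c t \<in> W"
    and f: "jet_smooth_on k W f"
    and g: "invertible (metric k f (curve_coords \<phi> k c t))"
    and diff: "\<And>\<alpha> i. \<alpha> \<le> k \<Longrightarrow> (deriv ^^ \<alpha>) (\<lambda>\<tau>. \<phi> (c \<tau>) $ i) field_differentiable at t"
  shows "lagrange_equations k f F \<phi> c t \<longleftrightarrow> spray_equations k f F \<phi> c t"
proof -
  let ?u = "curve_coords \<phi> k c t"
  let ?g = "metric k f ?u"
  define z :: "real^'n" where "z = (\<chi> i. (deriv ^^ (k + 1)) (\<lambda>\<tau>. \<phi> (c \<tau>) $ i) t)"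
  define e :: "real^'n"
    where "e = (\<chi> i. Gamma_op k (jet_partial k i f) ?u - jet_partial (k - 1) i f ?u)"
  have z: "(deriv ^^ (k + 1)) (\<lambda>\<tau>. \<phi> (c \<tau>) $ i) t = z $ i" for i
    by (simp add: z_def)
  have e: "Gamma_op k (jet_partial k i f) ?u - jet_partial (k - 1) i f ?u = e $ i" for i
    by (simp add: e_def)
  have total: "deriv (\<lambda>\<tau>. jet_partial k i f (curve_coords \<phi> k c \<tau>)) t - jet_partial (k - 1) i f ?u
      = (e + (1 / (fact k / 2)) *\<^sub>R (?g *v z)) $ i" for i
  proof -
    have "Cr_on (Suc 1) {jet_displace \<alpha> i |\<alpha> i. \<alpha> \<le> k} W f"
      using f unfolding jet_smooth_on_def smooth_along_def by blast
    then have "Cr_on 1 {jet_displace \<alpha> i |\<alpha> i. \<alpha> \<le> k} W (jet_partial k i f)"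
      unfolding Cr_on.simps(2) jet_partial_def by blast
    from deriv_along_curve_coords[OF W in_W this diff]
    have "deriv (\<lambda>\<tau>. jet_partial k i f (curve_coords \<phi> k c \<tau>)) t =
        Gamma_op k (jet_partial k i f) ?u
        + (\<Sum>j\<in>UNIV. z $ j / fact k * jet_partial k j (jet_partial k i f) ?u)"
      by (simp only: z)
    \<comment> \<open>The chain rule gives the transposed entry of the metric.\<close>
    moreover have "jet_partial k j (jet_partial k i f) ?u = 2 * ?g $ i $ j" for j
      using metric_symmetric[OF W in_W f, of i j] by (simp add: metric_def)
    moreover have "(\<Sum>j\<in>UNIV. z $ j / fact k * (2 * ?g $ i $ j)) = 1 / (fact k / 2) * (?g *v z) $ i"
      unfolding matrix_vector_mult_def vec_lambda_beta sum_distrib_left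
      by (intro sum.cong refl) simp
    ultimately show ?thesis
      by (simp add: e_def)
  qed
  have force: "covariant_components k f F ?u = ?g *v F ?u"
    by (simp add: covariant_components_def matrix_vector_mult_def)
  have spray: "fact (k + 1) * spray_coeff k f ?u $ i = ((fact k / 2) *\<^sub>R (matrix_inv ?g *v e)) $ i" for i
  proof -
    have "fact (k + 1) * (1 / real (k + 1) * (1 / 2 * s)) = fact k / 2 * s" for s :: real
      by (simp add: fact_Suc del: of_nat_Suc)
    then show ?thesis
      unfolding spray_coeff_def e matrix_vector_mult_def vec_lambda_beta vector_scaleR_component
        real_scaleR_def .
  qed
  have "lagrange_equations k f F \<phi> c t \<longleftrightarrow> e + (1 / (fact k / 2)) *\<^sub>R (?g *v z) = ?g *v F ?u"
    unfolding lagrange_equations_def total force vec_eq_iff ..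
  also have "\<dots> \<longleftrightarrow> z + (fact k / 2) *\<^sub>R (matrix_inv ?g *v e) = (fact k / 2) *\<^sub>R F ?u"
    by (rule solve_by_matrix_inv[OF g]) simp
  also have "\<dots> \<longleftrightarrow> spray_equations k f F \<phi> c t"
    unfolding spray_equations_def spray z vec_eq_iff by simp
  finally show ?thesis .
qed

theorem theorem5p3p1:
  fixes X :: "'m topology"
    and A :: "('m, 'n::finite) chart set"
    and L :: "(real \<Rightarrow> 'm) set \<Rightarrow> real"
    and F :: "('m, 'n) chart \<Rightarrow> (nat \<Rightarrow> real^'n) \<Rightarrow> real^'n"
    and k :: nat
    and c :: "real \<Rightarrow> 'm"
    and I :: "real set"
    and U :: "'m set" and \<phi> :: "'m \<Rightarrow> real^'n"
  assumes "k \<ge> 1"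
    and "lagrangian_mechanical_system X A k L F"
    and "open I" and "is_interval I"
    and "Cr_curve X A (k + 1) I c"
    and "\<forall>t\<in>I. jet X A k (\<lambda>s. c (t + s)) \<in> slit_acc_bundle X A k"
    and "(U, \<phi>) \<in> A"
  shows "(\<forall>t\<in>I. c t \<in> U \<longrightarrow> lagrange_equations k (local_rep X A k L (U, \<phi>)) (F (U, \<phi>)) \<phi> c t)
     \<longleftrightarrow> (\<forall>t\<in>I. c t \<in> U \<longrightarrow> spray_equations k (local_rep X A k L (U, \<phi>)) (F (U, \<phi>)) \<phi> c t)"
proof -
  let ?f = "local_rep X A k L (U, \<phi>)" and ?W = "slit_jet_domain (U, \<phi>) k"
  have space: "lagrange_space X A k L"
    using assms(2) by (simp add: lagrangian_mechanical_system_def)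
  then have "is_chart X (U, \<phi>)"
    using assms(7) by (auto simp: lagrange_space_def smooth_manifold_def)
  then have W: "openin (top_of_set (jet_space k)) ?W"
    by (auto simp: is_chart_def intro: openin_slit_jet_domain)
  have f: "jet_smooth_on k ?W ?f" and g: "\<And>u. u \<in> ?W \<Longrightarrow> invertible (metric k ?f u)"
    using space assms(7) by (auto simp: lagrange_space_def)
  have "lagrange_equations k ?f (F (U, \<phi>)) \<phi> c t \<longleftrightarrow> spray_equations k ?f (F (U, \<phi>)) \<phi> c t"
    if t: "t \<in> I" "c t \<in> U" for t
  proof -
    have in_W: "curve_coords \<phi> k c t \<in> ?W"
      using curve_coords_in_slit_jet_domain[OF assms(5,3) t(1) assms(7) t(2)] assms(6) t(1) by blast
    show ?thesis
    proof (rule lagrange_iff_spray[OF W in_W f g[OF in_W]])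
      show "(deriv ^^ \<alpha>) (\<lambda>\<tau>. \<phi> (c \<tau>) $ i) field_differentiable at t" if "\<alpha> \<le> k" for \<alpha> i
        using assms(5,7) t that by (fastforce simp: Cr_curve_def Cr_real_on_def)
    qed
  qed
  then show ?thesis by blast
qed


end
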